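(* Let $G$ be an $n$-vertex graph with minimum degree $\delta$ and average degree $\overline{d}>0$, and let $\lambda$ be the minimum eigenvalue of the adjacency matrix of $G$. Then \[ \alpha(G)\leq \vartheta(G)\leq \frac{-\lambda n(\overline{d}-\lambda)}{(\delta-\lambda)^2}. \]
   Context: $\alpha(G)$ is the independence number. An orthonormal representation of an $n$-vertex graph $G$ is a set of unit real vectors $\{u_1,\dots,u_n\}$ with $u_i^\top u_j=0$ whenever $i,j$ are distinct nonadjacent vertices; its value is $\min_c\max_i 1/(c^\top u_i)^2$ over unit real vectors $c$; the Lov\'{a}sz number $\vartheta(G)$ is the minimum value over all orthonormal representations of $G$. *)

theory Defs
  imports
    "HOL-Library.Extended_Real"
    "Graph_Theory.Pair_Digraph"
    "Jordan_Normal_Form.Spectral_Radius"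
begin

text \<open>
  A finite simple graph is a \<^locale>\<open>pair_graph\<close>: a finite vertex set with an irreflexive,
  symmetric arc relation.  Each edge is thus a pair of opposite arcs, and the degree of a
  vertex is its out-degree.
\<close>

definition min_degree :: "'a pair_pre_digraph \<Rightarrow> nat" where
  "min_degree G = Min (out_degree (with_proj G) ` pverts G)"

definition avg_degree :: "'a pair_pre_digraph \<Rightarrow> real" where
  "avg_degree G = (\<Sum>v\<in>pverts G. real (out_degree (with_proj G) v)) / real (card (pverts G))"

definition independent_set :: "'a pair_pre_digraph \<Rightarrow> 'a set \<Rightarrow> bool" where
  "independent_set G S \<longleftrightarrow> S \<subseteq> pverts G \<and> (\<forall>v\<in>S. \<forall>w\<in>S. (v, w) \<notin> parcs G)"

definition independence_number :: "'a pair_pre_digraph \<Rightarrow> nat" where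
  "independence_number G = Max (card ` {S. independent_set G S})"

text \<open>The list \<open>vs\<close> enumerates the vertices and fixes the order of rows and columns.\<close>

definition adjacency_matrix :: "'a pair_pre_digraph \<Rightarrow> 'a list \<Rightarrow> real mat" where
  "adjacency_matrix G vs =
     mat (length vs) (length vs) (\<lambda>(i, j). if (vs ! i, vs ! j) \<in> parcs G then 1 else 0)"

definition min_eigenvalue :: "real mat \<Rightarrow> real" where
  "min_eigenvalue A = Min (spectrum A)"

definition unit_vec_set :: "nat \<Rightarrow> real vec set" where
  "unit_vec_set d = {x \<in> carrier_vec d. x \<bullet> x = 1}"

text \<open>The dimension \<open>d\<close> of the ambient space is not bounded; the family \<open>u\<close> need not be injective.\<close>

definition orthonormal_rep :: "'a pair_pre_digraph \<Rightarrow> nat \<Rightarrow> ('a \<Rightarrow> real vec) \<Rightarrow> bool" where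
  "orthonormal_rep G d u \<longleftrightarrow>
     (\<forall>v\<in>pverts G. u v \<in> unit_vec_set d) \<and>
     (\<forall>v\<in>pverts G. \<forall>w\<in>pverts G. v \<noteq> w \<and> (v, w) \<notin> parcs G \<longrightarrow> u v \<bullet> u w = 0)"

text \<open>
  Values live in the extended reals, where \<open>1 / 0 = \<infinity>\<close>: a handle \<open>c\<close> orthogonal to some
  \<open>u v\<close> contributes \<open>\<infinity>\<close> to the minimum over \<open>c\<close> (in the reals it would be \<open>0\<close>).
  For a nonempty graph the minima below are attained: over \<open>c\<close> by lower semicontinuity on the
  compact unit sphere, and over representations because all vectors \<open>u v\<close> together with
  \<open>c\<close> can be moved into dimension \<open>card (pverts G) + 1\<close>.  So each infimum is the minimum.
\<close>

definition rep_value :: "'a pair_pre_digraph \<Rightarrow> nat \<Rightarrow> ('a \<Rightarrow> real vec) \<Rightarrow> ereal" where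
  "rep_value G d u = (INF c\<in>unit_vec_set d. MAX v\<in>pverts G. 1 / ereal ((c \<bullet> u v)\<^sup>2))"

definition lovasz_number :: "'a pair_pre_digraph \<Rightarrow> ereal" where
  "lovasz_number G = (INF (d, u)\<in>{(d, u). orthonormal_rep G d u}. rep_value G d u)"

lemma one_div_ereal_zero_sq: "1 / ereal (0\<^sup>2) = \<infinity>"
  by (simp add: divide_ereal_def zero_ereal_def[symmetric])

end

theory Submission
  imports Defs "HOL-Analysis.Function_Topology"
begin

text \<open>
  The vectors of an independent set are orthonormal, so by Bessel's inequality a unit handle \<open>c\<close>
  has \<open>(c \<bullet> u v)\<^sup>2 \<le> 1 / \<alpha>\<close> for some of them; this is the lower bound.

  For the upper bound, the minimum of the Rayleigh quotient of the adjacency matrix \<open>A\<close> is an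
  eigenvalue, hence equal to \<open>l\<close>, and \<open>A - l I\<close> is positive semidefinite.  An arc forces
  \<open>l < 0\<close>, so the matrix \<open>(A - l I) / (- l)\<close> has unit diagonal, vanishes at distinct
  nonadjacent pairs, and is the Gram matrix of an orthonormal representation \<open>u\<close>.  The handle is
  the normalised sum \<open>s\<close> of all \<open>u v\<close>: the row sums of the Gram matrix give
  \<open>s \<bullet> u v = (deg v - l) / (- l)\<close> and \<open>s \<bullet> s = n (d - l) / (- l)\<close>.
\<close>

section \<open>Bessel's inequality in coordinates\<close>

text \<open>The projection \<open>p\<close> of \<open>c\<close> onto the span of the
  \<open>u v\<close> satisfies \<open>c \<bullet> p = p \<bullet> p\<close>, and both equal the sum
  of the squared coefficients. Expanding the squared length of \<open>c - p\<close>, which is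
  nonnegative, gives the bound.\<close>

lemma bessel_inequality_sum:
  fixes c :: "nat \<Rightarrow> real" and u :: "'i \<Rightarrow> nat \<Rightarrow> real"
  assumes S: "finite S"
    and orth: "\<And>v w. v \<in> S \<Longrightarrow> w \<in> S \<Longrightarrow> (\<Sum>k<m. u v k * u w k) = (if v = w then 1 else 0)"
  shows "(\<Sum>v\<in>S. (\<Sum>k<m. c k * u v k)\<^sup>2) \<le> (\<Sum>k<m. (c k)\<^sup>2)"
proof -
  define a where "a v = (\<Sum>k<m. c k * u v k)" for v
  define p where "p k = (\<Sum>v\<in>S. a v * u v k)" for k
  have cp: "(\<Sum>k<m. c k * p k) = (\<Sum>v\<in>S. (a v)\<^sup>2)"
  proof -
    have "(\<Sum>k<m. c k * p k) = (\<Sum>k<m. \<Sum>v\<in>S. a v * (c k * u v k))"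
      by (simp add: p_def sum_distrib_left mult_ac)
    also have "\<dots> = (\<Sum>v\<in>S. a v * (\<Sum>k<m. c k * u v k))"
      by (subst sum.swap) (simp add: sum_distrib_left)
    finally show ?thesis by (simp add: a_def power2_eq_square)
  qed
  have pu: "(\<Sum>k<m. p k * u w k) = a w" if "w \<in> S" for w
  proof -
    have "(\<Sum>k<m. p k * u w k) = (\<Sum>k<m. \<Sum>v\<in>S. a v * (u v k * u w k))"
      by (simp add: p_def sum_distrib_left mult_ac)
    also have "\<dots> = (\<Sum>v\<in>S. a v * (\<Sum>k<m. u v k * u w k))"
      by (subst sum.swap) (simp add: sum_distrib_left)
    also have "\<dots> = (\<Sum>v\<in>S. if v = w then a v else 0)"
      using that by (intro sum.cong) (auto simp: orth)
    finally show ?thesis using that S by simp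
  qed
  have pp: "(\<Sum>k<m. p k * p k) = (\<Sum>v\<in>S. (a v)\<^sup>2)"
  proof -
    have "(\<Sum>k<m. p k * p k) = (\<Sum>k<m. p k * (\<Sum>v\<in>S. a v * u v k))"
      by (simp add: p_def)
    also have "\<dots> = (\<Sum>k<m. \<Sum>v\<in>S. a v * (p k * u v k))"
      by (simp add: sum_distrib_left mult_ac)
    also have "\<dots> = (\<Sum>v\<in>S. a v * (\<Sum>k<m. p k * u v k))"
      by (subst sum.swap) (simp add: sum_distrib_left)
    finally show ?thesis by (simp add: pu power2_eq_square)
  qed
  have "0 \<le> (\<Sum>k<m. (c k - p k)\<^sup>2)"
    by (intro sum_nonneg) simp
  also have "\<dots> = (\<Sum>k<m. (c k)\<^sup>2 - 2 * (c k * p k) + p k * p k)"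
    by (intro sum.cong refl) (simp add: power2_eq_square algebra_simps)
  also have "\<dots> = (\<Sum>k<m. (c k)\<^sup>2) - 2 * (\<Sum>k<m. c k * p k) + (\<Sum>k<m. p k * p k)"
    by (simp only: sum.distrib sum_subtractf sum_distrib_left)
  finally show ?thesis by (simp add: cp pp a_def)
qed

section \<open>Quadratic forms and Gram factorisation\<close>

text \<open>An arbitrary index set allows induction on \<open>I\<close> and direct use of vertices
  as indices, without an enumeration.\<close>

definition quad_form :: "'i set \<Rightarrow> ('i \<Rightarrow> 'i \<Rightarrow> real) \<Rightarrow> ('i \<Rightarrow> real) \<Rightarrow> real" where
  "quad_form I b x = (\<Sum>i\<in>I. \<Sum>j\<in>I. x i * x j * b i j)"

text \<open>Symmetry merges the two cross terms. The coefficient of \<open>2 * t\<close> pairs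
  \<open>y\<close> with the matrix applied to \<open>x\<close>, which is what a first-order
  condition at a minimiser needs.\<close>

lemma quad_form_add_scaled:
  assumes "\<And>i j. i \<in> I \<Longrightarrow> j \<in> I \<Longrightarrow> b i j = b j i"
  shows "quad_form I b (\<lambda>i. x i + t * y i) =
    quad_form I b x + 2 * t * (\<Sum>i\<in>I. y i * (\<Sum>j\<in>I. b i j * x j)) + t\<^sup>2 * quad_form I b y"
proof -
  have swap: "(\<Sum>i\<in>I. \<Sum>j\<in>I. x i * y j * b i j) = (\<Sum>i\<in>I. \<Sum>j\<in>I. y i * x j * b i j)"
    by (subst sum.swap) (intro sum.cong refl, simp add: assms mult_ac)
  have "quad_form I b (\<lambda>i. x i + t * y i) =
    (\<Sum>i\<in>I. \<Sum>j\<in>I. x i * x j * b i j + t * (x i * y j * b i j) + t * (y i * x j * b i j)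
      + t\<^sup>2 * (y i * y j * b i j))"
    unfolding quad_form_def by (intro sum.cong refl) (simp add: power2_eq_square algebra_simps)
  also have "\<dots> = quad_form I b x + t * (\<Sum>i\<in>I. \<Sum>j\<in>I. x i * y j * b i j)
      + t * (\<Sum>i\<in>I. \<Sum>j\<in>I. y i * x j * b i j) + t\<^sup>2 * quad_form I b y"
    by (simp only: quad_form_def sum.distrib sum_distrib_left)
  also have "\<dots> = quad_form I b x + 2 * t * (\<Sum>i\<in>I. \<Sum>j\<in>I. y i * x j * b i j)
      + t\<^sup>2 * quad_form I b y"
    unfolding swap by simp
  also have "(\<Sum>i\<in>I. \<Sum>j\<in>I. y i * x j * b i j) = (\<Sum>i\<in>I. y i * (\<Sum>j\<in>I. b i j * x j))"
    by (simp add: sum_distrib_left mult_ac)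
  finally show ?thesis .
qed

lemma quad_form_insert:
  assumes "finite I" "p \<notin> I" and "\<And>i. i \<in> I \<Longrightarrow> b i p = b p i"
  shows "quad_form (insert p I) b x =
    (x p)\<^sup>2 * b p p + 2 * x p * (\<Sum>i\<in>I. x i * b p i) + quad_form I b x"
proof -
  have "(\<Sum>i\<in>I. x i * x p * b i p) = x p * (\<Sum>i\<in>I. x i * b p i)"
    by (simp add: sum_distrib_left assms mult_ac)
  moreover have "(\<Sum>i\<in>I. x p * x i * b p i) = x p * (\<Sum>i\<in>I. x i * b p i)"
    by (simp add: sum_distrib_left mult_ac)
  ultimately show ?thesis
    using assms(1,2) by (simp add: quad_form_def sum.distrib power2_eq_square algebra_simps)
qed

text \<open>For small \<open>t\<close> the linear term dominates, and it changes sign with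
  \<open>t\<close>. This serves both for the row of a zero pivot and for the first-order condition
  at a Rayleigh minimiser.\<close>

lemma linear_coeff_zero_if_quadratic_nonneg:
  fixes a b :: real
  assumes "\<And>t. 0 \<le> 2 * t * a + t\<^sup>2 * b"
  shows "a = 0"
proof (rule ccontr)
  assume a: "a \<noteq> 0"
  \<comment> \<open>As \<open>K\<close> exceeds \<open>\<bar>b\<bar>\<close>, at
    \<open>t = - a / K\<close> the negative linear term outweighs the quadratic one.\<close>
  define K where "K = \<bar>b\<bar> + 1"
  have K: "K > 0" "b < 2 * K" by (auto simp: K_def)
  have "2 * (- a / K) * a + (- a / K)\<^sup>2 * b = (a / K)\<^sup>2 * (b - 2 * K)"
    using K by (simp add: field_simps power2_eq_square)
  also have "\<dots> < 0" using a K by (intro mult_pos_neg) auto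
  finally show False using assms[of "- a / K"] by simp
qed

text \<open>Cholesky decomposition: eliminate one index \<open>p\<close> by passing to the Schur complement.\<close>

lemma psd_imp_gram:
  assumes "finite I"
    and "\<And>i j. i \<in> I \<Longrightarrow> j \<in> I \<Longrightarrow> b i j = b j i"
    and "\<And>x. 0 \<le> quad_form I b x"
  shows "\<exists>(m::nat) u. \<forall>i\<in>I. \<forall>j\<in>I. b i j = (\<Sum>k<m. u i k * u j k)"
  using assms
proof (induction I arbitrary: b rule: finite_induct)
  case empty
  then show ?case by simp
next
  case (insert p I)
  have sym: "b i j = b j i" if "i \<in> insert p I" "j \<in> insert p I" for i j
    using insert.prems(1) that by blast
  have psd: "0 \<le> (x p)\<^sup>2 * b p p + 2 * x p * (\<Sum>i\<in>I. x i * b p i) + quad_form I b x" for x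
    using insert.prems(2)[of x] quad_form_insert[OF insert.hyps(1,2), of b x] sym by simp
  have cong: "quad_form I b (x(p := t)) = quad_form I b x"
    "(\<Sum>i\<in>I. (x(p := t)) i * b p i) = (\<Sum>i\<in>I. x i * b p i)" for x t
    using insert.hyps(2) by (auto simp: quad_form_def intro!: sum.cong)
  \<comment> \<open>The coordinate at \<open>p\<close> becomes a free parameter \<open>t\<close>,
    because the sums over \<open>I\<close> do not see it.\<close>
  have psd': "0 \<le> t\<^sup>2 * b p p + 2 * t * (\<Sum>i\<in>I. x i * b p i) + quad_form I b x" for x t
    using psd[of "x(p := t)"] unfolding cong by simp
  have bpp: "b p p \<ge> 0"
    using psd'[of 1 "\<lambda>_. 0"] by (simp add: quad_form_def)
  \<comment> \<open>This is the column of the Cholesky factor belonging to \<open>p\<close>. If the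
    pivot \<open>b p p\<close> is 0, division by zero makes \<open>h\<close> vanish, so that
    \<open>b'\<close> is just \<open>b\<close>; the formula for \<open>quad_form I b'\<close> below
    then holds as well.\<close>
  define h where "h i = b p i / sqrt (b p p)" for i
  define b' where "b' i j = b i j - h i * h j" for i j
  have qf': "quad_form I b' x = quad_form I b x - (\<Sum>i\<in>I. x i * b p i)\<^sup>2 / b p p" for x
  proof -
    have "(\<Sum>i\<in>I. \<Sum>j\<in>I. x i * x j * (h i * h j)) = (\<Sum>i\<in>I. x i * h i) * (\<Sum>j\<in>I. x j * h j)"
      by (simp add: sum_product mult_ac)
    also have "(\<Sum>i\<in>I. x i * h i) = (\<Sum>i\<in>I. x i * b p i) / sqrt (b p p)"
      by (simp add: h_def sum_divide_distrib)
    finally show ?thesis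
      using bpp by (simp add: quad_form_def b'_def right_diff_distrib sum_subtractf power2_eq_square)
  qed
  have nn: "0 \<le> quad_form I b' x" for x
  proof (cases "b p p = 0")
    case True
    then show ?thesis using psd'[of 0 x] by (simp add: qf')
  next
    case False
    then show ?thesis
      \<comment> \<open>This \<open>t\<close> minimises the quadratic in \<open>t\<close>, and the
        minimum is the form of the Schur complement.\<close>
      using psd'[of "- (\<Sum>i\<in>I. x i * b p i) / b p p" x]
      by (simp add: qf' power2_eq_square field_simps)
  qed
  have "\<exists>(m::nat) u. \<forall>i\<in>I. \<forall>j\<in>I. b' i j = (\<Sum>k<m. u i k * u j k)"
    by (rule insert.IH[OF _ nn]) (simp add: b'_def sym mult.commute)
  then obtain m :: nat and u where u: "\<And>i j. i \<in> I \<Longrightarrow> j \<in> I \<Longrightarrow> b' i j = (\<Sum>k<m. u i k * u j k)"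
    by blast
  \<comment> \<open>Coordinate \<open>m\<close> is new and carries \<open>h\<close>. The induction
    hypothesis says nothing about \<open>u p\<close>, so the old coordinates of \<open>p\<close> are
    set to 0.\<close>
  define u' where "u' i k = (if k = m then h i else if i = p then 0 else u i k)" for i k
  \<comment> \<open>A zero pivot forces its whole row to vanish: test with 1 at \<open>p\<close> and
    \<open>t\<close> at \<open>i\<close>.\<close>
  have zero: "b p i = 0" if "b p p = 0" "i \<in> I" for i
  proof (rule linear_coeff_zero_if_quadratic_nonneg)
    fix t
    have "(\<Sum>j\<in>I. t * (if j = i then 1 else 0) * b p j) = (\<Sum>j\<in>I. if j = i then t * b p j else 0)"
      by (intro sum.cong) auto
    then have S: "(\<Sum>j\<in>I. t * (if j = i then 1 else 0) * b p j) = t * b p i"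
      using that(2) insert.hyps(1) by simp
    have "quad_form I b (\<lambda>j. t * (if j = i then 1 else 0)) =
      t\<^sup>2 * quad_form I b (\<lambda>j. if j = i then 1 else 0)"
      unfolding quad_form_def sum_distrib_left by (intro sum.cong) (auto simp: power2_eq_square)
    then show "0 \<le> 2 * t * b p i + t\<^sup>2 * quad_form I b (\<lambda>j. if j = i then 1 else 0)"
      using psd'[of 1 "\<lambda>j. t * (if j = i then 1 else 0)"] that(1) by (simp only: S)
  qed
  have hp: "h p * h i = b p i" if "i \<in> insert p I" for i
  proof (cases "b p p = 0")
    case True
    then show ?thesis using that zero by (auto simp: h_def)
  next
    case False
    then show ?thesis using bpp by (simp add: h_def)
  qed
  have "b i j = (\<Sum>k<Suc m. u' i k * u' j k)" if "i \<in> insert p I" "j \<in> insert p I" for i j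
  proof (cases "i = p \<or> j = p")
    case True
    then have "(\<Sum>k<m. u' i k * u' j k) = 0"
      by (intro sum.neutral) (auto simp: u'_def)
    moreover have "h i * h j = b i j"
      using True that hp sym by (auto simp: mult.commute)
    ultimately show ?thesis by (simp add: u'_def)
  next
    case False
    then have "(\<Sum>k<m. u' i k * u' j k) = b' i j"
      using that u by (auto simp: u'_def intro!: sum.cong)
    then show ?thesis by (simp add: u'_def b'_def)
  qed
  then show ?case by blast
qed

section \<open>Minimising the Rayleigh quotient\<close>

text \<open>The form attains its minimum on the compact unit sphere. Scaling extends the lower bound
  to all vectors, and varying one coordinate of the minimiser yields the eigenvalue
  equation.\<close>

lemma rayleigh_minimum:
  fixes b :: "'i \<Rightarrow> 'i \<Rightarrow> real"
  assumes fin: "finite I" and ne: "I \<noteq> {}"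
    and sym: "\<And>i j. i \<in> I \<Longrightarrow> j \<in> I \<Longrightarrow> b i j = b j i"
  obtains \<mu> x where "\<exists>i\<in>I. x i \<noteq> 0"
    and "\<And>i. i \<in> I \<Longrightarrow> (\<Sum>j\<in>I. b i j * x j) = \<mu> * x i"
    and "\<And>y. \<mu> * (\<Sum>i\<in>I. (y i)\<^sup>2) \<le> quad_form I b y"
proof -
  \<comment> \<open>The type \<open>'i\<close> may be infinite. Pinning the coordinates outside
    \<open>I\<close> to 0 makes \<open>C\<close> a product of compact sets, and the box on
    \<open>I\<close> contains every unit vector.\<close>
  define C :: "('i \<Rightarrow> real) set" where "C = (\<Pi>\<^sub>E i\<in>UNIV. if i \<in> I then {-1..1} else {0})"
  define D where "D = C \<inter> {x. (\<Sum>i\<in>I. (x i)\<^sup>2) = 1}"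
  have cont: "continuous_on UNIV (\<lambda>x::'i \<Rightarrow> real. x i)" for i
    by (rule continuous_on_product_coordinates)
  have contb: "continuous_on UNIV (quad_form I b)"
    unfolding quad_form_def by (intro continuous_intros cont)
  have "compactin (product_topology (\<lambda>i. euclidean) UNIV) C"
    unfolding C_def by (subst compactin_PiE) auto
  then have "compact C"
    by (simp add: euclidean_product_topology)
  moreover have "closed {x::'i \<Rightarrow> real. (\<Sum>i\<in>I. (x i)\<^sup>2) = 1}"
    by (intro closed_Collect_eq continuous_intros cont)
  ultimately have "compact D" unfolding D_def by (rule compact_Int_closed)
  obtain i0 where i0: "i0 \<in> I" using ne by blast
  have "(\<Sum>i\<in>I. (if i = i0 then 1 else 0::real)\<^sup>2) = (\<Sum>i\<in>I. if i = i0 then 1 else 0)"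
    by (intro sum.cong) auto
  then have "(\<lambda>i. if i = i0 then 1 else 0) \<in> D"
    using i0 fin by (auto simp: D_def C_def)
  then have "D \<noteq> {}" by blast
  from continuous_attains_inf[OF \<open>compact D\<close> this continuous_on_subset[OF contb]]
  obtain x where x: "x \<in> D" and min: "\<And>y. y \<in> D \<Longrightarrow> quad_form I b x \<le> quad_form I b y"
    by blast
  define \<mu> where "\<mu> = quad_form I b x"
  have x1: "(\<Sum>i\<in>I. (x i)\<^sup>2) = 1" using x by (simp add: D_def)
  have low: "\<mu> * (\<Sum>i\<in>I. (y i)\<^sup>2) \<le> quad_form I b y" for y
  proof (cases "\<forall>i\<in>I. y i = 0")
    case True
    then show ?thesis by (simp add: quad_form_def)
  next
    case False
    define N where "N = (\<Sum>i\<in>I. (y i)\<^sup>2)"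
    have N: "N > 0"
      using False fin unfolding N_def by (auto intro: sum_pos2)
    \<comment> \<open>Normalising is not enough for membership in \<open>D\<close>: the values of
      \<open>y\<close> outside \<open>I\<close> must also be replaced by 0.\<close>
    define z where "z i = (if i \<in> I then y i / sqrt N else 0)" for i
    have z1: "(\<Sum>i\<in>I. (z i)\<^sup>2) = 1"
    proof -
      have "(\<Sum>i\<in>I. (z i)\<^sup>2) = (\<Sum>i\<in>I. (y i)\<^sup>2 / N)"
        using N by (intro sum.cong) (auto simp: z_def power_divide)
      also have "\<dots> = 1" using N by (simp add: sum_divide_distrib[symmetric] N_def[symmetric])
      finally show ?thesis .
    qed
    have "\<bar>z i\<bar> \<le> 1" if "i \<in> I" for i
    proof -
      have "(z i)\<^sup>2 \<le> (\<Sum>i\<in>I. (z i)\<^sup>2)"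
        using that fin by (intro member_le_sum) auto
      then show ?thesis by (simp add: z1 abs_square_le_1)
    qed
    then have "z \<in> D"
      by (auto simp: D_def C_def z1 abs_le_iff) (auto simp: z_def minus_le_iff)
    then have "\<mu> \<le> quad_form I b z" unfolding \<mu>_def by (rule min)
    also have "quad_form I b z = (\<Sum>i\<in>I. \<Sum>j\<in>I. y i * y j * b i j / N)"
      unfolding quad_form_def using N by (intro sum.cong) (auto simp: z_def)
    also have "\<dots> = quad_form I b y / N"
      by (simp add: quad_form_def sum_divide_distrib)
    finally show ?thesis using N by (simp add: N_def[symmetric] field_simps)
  qed
  have "(\<Sum>j\<in>I. b i j * x j) - \<mu> * x i = 0" if i: "i \<in> I" for i
  proof (rule linear_coeff_zero_if_quadratic_nonneg)
    fix t
    define e where "e j = (if j = i then 1 else 0::real)" for j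
    have e: "(\<Sum>j\<in>I. e j * f j) = f i" for f
    proof -
      have "(\<Sum>j\<in>I. e j * f j) = (\<Sum>j\<in>I. if j = i then f j else 0)"
        by (intro sum.cong) (auto simp: e_def)
      then show ?thesis using i fin by simp
    qed
    have "(\<Sum>j\<in>I. (x j + t * e j)\<^sup>2) =
      (\<Sum>j\<in>I. (x j)\<^sup>2) + 2 * t * (\<Sum>j\<in>I. e j * x j) + t\<^sup>2 * (\<Sum>j\<in>I. e j * e j)"
    proof -
      have "(\<Sum>j\<in>I. (x j + t * e j)\<^sup>2) =
        (\<Sum>j\<in>I. (x j)\<^sup>2 + 2 * t * (e j * x j) + t\<^sup>2 * (e j * e j))"
        by (intro sum.cong refl) (simp add: power2_eq_square algebra_simps)
      then show ?thesis by (simp only: sum.distrib sum_distrib_left)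
    qed
    then have "(\<Sum>j\<in>I. (x j + t * e j)\<^sup>2) = 1 + 2 * t * x i + t\<^sup>2"
      unfolding e x1 by (simp add: e_def)
    moreover have "quad_form I b (\<lambda>j. x j + t * e j) =
        \<mu> + 2 * t * (\<Sum>j\<in>I. b i j * x j) + t\<^sup>2 * quad_form I b e"
      by (subst quad_form_add_scaled) (simp_all add: sym e \<mu>_def)
    ultimately have "\<mu> * (1 + 2 * t * x i + t\<^sup>2) \<le>
        \<mu> + 2 * t * (\<Sum>j\<in>I. b i j * x j) + t\<^sup>2 * quad_form I b e"
      using low[of "\<lambda>j. x j + t * e j"] by simp
    \<comment> \<open>The constant terms \<open>\<mu>\<close> cancel, which leaves a quadratic in
      \<open>t\<close> without constant term.\<close>
    then show "0 \<le> 2 * t * ((\<Sum>j\<in>I. b i j * x j) - \<mu> * x i) + t\<^sup>2 * (quad_form I b e - \<mu>)"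
      by (simp add: algebra_simps)
  qed
  then have eig: "(\<Sum>j\<in>I. b i j * x j) = \<mu> * x i" if "i \<in> I" for i
    using that by simp
  have "\<exists>i\<in>I. x i \<noteq> 0"
  proof (rule ccontr)
    assume "\<not> ?thesis"
    then have "(\<Sum>i\<in>I. (x i)\<^sup>2) = 0" by simp
    with x1 show False by simp
  qed
  from that[OF this eig low] show thesis by blast
qed


section \<open>The lower bound on the Lovasz number\<close>

text \<open>Both infima are bounded below termwise, so one representation and one handle are treated
  at a time, with a maximum independent set \<open>S\<close>.\<close>

lemma lovasz_number_ge_independence_number:
  assumes fin: "finite (pverts G)" and ne: "pverts G \<noteq> {}"
  shows "ereal (real (independence_number G)) \<le> lovasz_number G"
proof -
  have "finite {S. independent_set G S}"
    by (rule finite_subset[of _ "Pow (pverts G)"]) (auto simp: independent_set_def fin)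
  moreover have "independent_set G {}" by (simp add: independent_set_def)
  ultimately have "independence_number G \<in> card ` {S. independent_set G S}"
    unfolding independence_number_def by (intro Max_in) auto
  then obtain S where S: "independent_set G S" and \<alpha>: "independence_number G = card S"
    by auto
  have SV: "S \<subseteq> pverts G" using S by (simp add: independent_set_def)
  have finS: "finite S" using SV fin by (rule finite_subset)
  have main: "ereal (real (card S)) \<le> (MAX v\<in>pverts G. 1 / ereal ((c \<bullet> u v)\<^sup>2))"
    if rep: "orthonormal_rep G m u" and c: "c \<in> unit_vec_set m" for m u c
  proof -
    have dim: "dim_vec (u v) = m" "dim_vec c = m" if "v \<in> pverts G" for v
      using rep c that by (auto simp: orthonormal_rep_def unit_vec_set_def)
    have orth: "(\<Sum>k<m. u v $ k * u w $ k) = (if v = w then 1 else 0)" if "v \<in> S" "w \<in> S" for v w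
    proof -
      have vw: "v \<in> pverts G" "w \<in> pverts G" "(v, w) \<notin> parcs G"
        using S that by (auto simp: independent_set_def)
      then have "u v \<bullet> u w = (if v = w then 1 else 0)"
        using rep by (auto simp: orthonormal_rep_def unit_vec_set_def)
      then show ?thesis
        using dim vw by (simp add: scalar_prod_def atLeast0LessThan)
    qed
    have cu: "(\<Sum>k<m. c $ k * u v $ k) = c \<bullet> u v" if "v \<in> S" for v
      using dim that SV by (auto simp: scalar_prod_def atLeast0LessThan)
    have "c \<bullet> c = 1" "dim_vec c = m" using c by (auto simp: unit_vec_set_def)
    then have c1: "(\<Sum>k<m. (c $ k)\<^sup>2) = 1"
      by (simp add: scalar_prod_def atLeast0LessThan power2_eq_square)
    have bessel: "(\<Sum>v\<in>S. (c \<bullet> u v)\<^sup>2) \<le> 1"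
      using bessel_inequality_sum[OF finS orth, of "vec_index c"] by (simp add: cu c1)
    have "\<exists>v\<in>pverts G. ereal (real (card S)) \<le> 1 / ereal ((c \<bullet> u v)\<^sup>2)"
    proof (cases "S = {}")
      case True
      then show ?thesis using ne by (auto simp: zero_ereal_def[symmetric])
    next
      case False
      then have card: "real (card S) > 0" using finS by (simp add: card_gt_0_iff)
      \<comment> \<open>Averaging: the squares sum to at most 1 over \<open>card S\<close>
        vertices.\<close>
      have "\<exists>v\<in>S. (c \<bullet> u v)\<^sup>2 \<le> 1 / real (card S)"
      proof (rule ccontr)
        assume "\<not> ?thesis"
        then have "(\<Sum>v\<in>S. 1 / real (card S)) < (\<Sum>v\<in>S. (c \<bullet> u v)\<^sup>2)"
          using finS False by (intro sum_strict_mono) auto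
        then show False using bessel card by simp
      qed
      then obtain v where v: "v \<in> S" "(c \<bullet> u v)\<^sup>2 \<le> 1 / real (card S)" by blast
      have "ereal (real (card S)) \<le> 1 / ereal ((c \<bullet> u v)\<^sup>2)"
      proof (cases "c \<bullet> u v = 0")
        case True
        then show ?thesis by (simp only: one_div_ereal_zero_sq) simp
      next
        case False
        then have "real (card S) \<le> 1 / (c \<bullet> u v)\<^sup>2"
          using v(2) card by (simp add: field_simps)
        then show ?thesis using False by (simp add: one_ereal_def)
      qed
      then show ?thesis using v(1) SV by blast
    qed
    then show ?thesis using fin ne by (subst Max_ge_iff) auto
  qed
  show ?thesis
    unfolding lovasz_number_def rep_value_def \<alpha> by (auto intro!: INF_greatest main)
qed

section \<open>The least eigenvalue of the adjacency matrix\<close>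

text \<open>Vectors are carried between vertices and positions in \<open>vs\<close>. The Rayleigh
  minimiser becomes an eigenvector, so \<open>\<mu>\<close> lies in the spectrum; conversely, an
  eigenvector for \<open>k\<close> has Rayleigh quotient \<open>k\<close>, so
  \<open>\<mu> \<le> k\<close>.\<close>

lemma min_eigenvalue_adjacency_matrix:
  fixes G :: "'a pair_pre_digraph"
  defines "a \<equiv> \<lambda>v w. if (v, w) \<in> parcs G then 1 else (0::real)"
  assumes G: "pair_graph G" and ne: "pverts G \<noteq> {}"
    and vs: "distinct vs" "set vs = pverts G"
  shows "min_eigenvalue (adjacency_matrix G vs) * (\<Sum>v\<in>pverts G. (y v)\<^sup>2)
    \<le> quad_form (pverts G) a y"
proof -
  interpret pair_graph G by (rule G)
  have sym: "a v w = a w v" for v w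
    using pair_sym_arcs by (auto simp: a_def symmetric_def dest: symD)
  obtain \<mu> x where nz: "\<exists>v\<in>pverts G. x v \<noteq> 0"
    and eig: "\<And>v. v \<in> pverts G \<Longrightarrow> (\<Sum>w\<in>pverts G. a v w * x w) = \<mu> * x v"
    and low: "\<And>y. \<mu> * (\<Sum>v\<in>pverts G. (y v)\<^sup>2) \<le> quad_form (pverts G) a y"
    by (rule rayleigh_minimum[OF pair_finite_verts ne, of a, OF sym]) (rule that)
  define A where "A = adjacency_matrix G vs"
  define n where "n = length vs"
  have A: "A \<in> carrier_mat n n" by (simp add: A_def adjacency_matrix_def n_def)
  have bij: "bij_betw ((!) vs) {..<n} (pverts G)"
    using vs by (simp add: bij_betw_nth n_def)
  have mult: "(A *\<^sub>v z) $ i = (\<Sum>j<n. a (vs ! i) (vs ! j) * z $ j)"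
    if "i < n" "z \<in> carrier_vec n" for i z
    using that A
    by (auto simp: scalar_prod_def A_def adjacency_matrix_def n_def a_def atLeast0LessThan
        intro!: sum.cong)
  have "eigenvector A (vec n (\<lambda>i. x (vs ! i))) \<mu>"
  proof -
    obtain v where "v \<in> pverts G" "x v \<noteq> 0" using nz by blast
    then obtain i where i: "i < n" "x (vs ! i) \<noteq> 0"
      using vs(2) by (metis in_set_conv_nth n_def)
    then have "vec n (\<lambda>i. x (vs ! i)) \<noteq> 0\<^sub>v n"
      by (metis index_vec index_zero_vec(1))
    moreover have "A *\<^sub>v vec n (\<lambda>i. x (vs ! i)) = \<mu> \<cdot>\<^sub>v vec n (\<lambda>i. x (vs ! i))"
    proof (rule eq_vecI)
      fix i assume "i < dim_vec (\<mu> \<cdot>\<^sub>v vec n (\<lambda>i. x (vs ! i)))"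
      then have i: "i < n" by simp
      have "(A *\<^sub>v vec n (\<lambda>i. x (vs ! i))) $ i = (\<Sum>j<n. a (vs ! i) (vs ! j) * x (vs ! j))"
        using i by (simp add: mult)
      also have "\<dots> = (\<Sum>w\<in>pverts G. a (vs ! i) w * x w)"
        by (rule sum.reindex_bij_betw[OF bij])
      also have "\<dots> = \<mu> * x (vs ! i)"
        by (rule eig) (use i nth_mem[of i vs] vs(2) in \<open>simp add: n_def\<close>)
      also have "\<dots> = (\<mu> \<cdot>\<^sub>v vec n (\<lambda>i. x (vs ! i))) $ i" using i by simp
      finally show "(A *\<^sub>v vec n (\<lambda>i. x (vs ! i))) $ i = (\<mu> \<cdot>\<^sub>v vec n (\<lambda>i. x (vs ! i))) $ i" .
    qed (simp add: carrier_matD[OF A])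
    ultimately show ?thesis by (simp add: eigenvector_def carrier_matD[OF A])
  qed
  then have mem: "\<mu> \<in> spectrum A" by (auto simp: spectrum_def eigenvalue_def)
  have least: "\<mu> \<le> k" if "k \<in> spectrum A" for k
  proof -
    obtain z where z: "z \<in> carrier_vec n" "z \<noteq> 0\<^sub>v n" "A *\<^sub>v z = k \<cdot>\<^sub>v z"
      using \<open>k \<in> spectrum A\<close> unfolding spectrum_def eigenvalue_def eigenvector_def carrier_matD[OF A]
      by blast
    \<comment> \<open>The eigenvector \<open>z\<close> is pulled back to the vertices along the
      inverse of the enumeration.\<close>
    define y where "y v = z $ (the_inv_into {..<n} ((!) vs) v)" for v
    have y: "y (vs ! i) = z $ i" if "i < n" for i
      using that bij by (simp add: y_def the_inv_into_f_f bij_betw_def)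
    have sq: "(\<Sum>v\<in>pverts G. (y v)\<^sup>2) = (\<Sum>i<n. (z $ i)\<^sup>2)"
      by (subst sum.reindex_bij_betw[OF bij, symmetric]) (simp add: y)
    have "quad_form (pverts G) a y =
        (\<Sum>i<n. \<Sum>j<n. y (vs ! i) * y (vs ! j) * a (vs ! i) (vs ! j))"
      unfolding quad_form_def by (simp only: sum.reindex_bij_betw[OF bij, symmetric])
    also have "\<dots> = (\<Sum>i<n. z $ i * (A *\<^sub>v z) $ i)"
      using z(1) by (intro sum.cong refl) (auto simp: mult y sum_distrib_left mult_ac intro!: sum.cong)
    also have "\<dots> = k * (\<Sum>i<n. (z $ i)\<^sup>2)"
      using z(1) unfolding z(3) sum_distrib_left
      by (intro sum.cong refl) (auto simp: power2_eq_square)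
    finally have *: "\<mu> * (\<Sum>i<n. (z $ i)\<^sup>2) \<le> k * (\<Sum>i<n. (z $ i)\<^sup>2)"
      using low[of y] by (simp add: sq)
    obtain i where "i < n" "z $ i \<noteq> 0"
      using z(1,2) by (metis carrier_vecD eq_vecI index_zero_vec)
    then have "(\<Sum>i<n. (z $ i)\<^sup>2) > 0"
      by (intro sum_pos2[of _ i]) auto
    then show ?thesis using * by simp
  qed
  have "min_eigenvalue A = \<mu>"
    unfolding min_eigenvalue_def
    by (rule Min_eqI[OF card_finite_spectrum(1)[OF A] least mem])
  then show ?thesis using low by (simp add: A_def)
qed

section \<open>The upper bound from an explicit representation\<close>

text \<open>The spectrum enters only through \<open>low\<close>: the bound holds for every
  \<open>l\<close> that makes the adjacency matrix minus \<open>l\<close> times the identity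
  positive semidefinite.\<close>

lemma lovasz_number_le_psd_bound:
  fixes G :: "'a pair_pre_digraph" and l :: real and \<delta> :: nat
  defines "a \<equiv> \<lambda>v w. if (v, w) \<in> parcs G then 1 else (0::real)"
  assumes G: "pair_graph G" and arcs: "parcs G \<noteq> {}"
    and low: "\<And>y. l * (\<Sum>v\<in>pverts G. (y v)\<^sup>2) \<le> quad_form (pverts G) a y"
  shows "lovasz_number G \<le> ereal (- l * real (card (pverts G)) * (avg_degree G - l)
    / (real (min_degree G) - l)\<^sup>2)"
proof -
  interpret pair_graph G by (rule G)
  note fin = pair_finite_verts
  obtain p q where pq: "(p, q) \<in> parcs G" using arcs by auto
  then have pqV: "p \<in> pverts G" "q \<in> pverts G" "p \<noteq> q"
    using in_arcsD1 in_arcsD2 pair_no_loops[OF pq] by auto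
  have ne: "pverts G \<noteq> {}" using pqV by auto
  have diag: "a v v = 0" for v using pair_no_loops[of "(v, v)"] by (auto simp: a_def)
  have sym: "a v w = a w v" for v w
    using pair_sym_arcs by (auto simp: a_def symmetric_def dest: symD)
  define M where "M v w = a v w - (if v = w then l else 0)" for v w
  have "quad_form (pverts G) M y = quad_form (pverts G) a y - l * (\<Sum>v\<in>pverts G. (y v)\<^sup>2)" for y
  proof -
    have "(\<Sum>w\<in>pverts G. y v * y w * (if v = w then l else 0)) = l * (y v)\<^sup>2"
      if "v \<in> pverts G" for v
    proof -
      have "(\<Sum>w\<in>pverts G. y v * y w * (if v = w then l else 0)) =
          (\<Sum>w\<in>pverts G. if v = w then l * (y v)\<^sup>2 else 0)"
        by (intro sum.cong) (auto simp: power2_eq_square)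
      then show ?thesis using that fin by simp
    qed
    then show ?thesis
      by (simp add: quad_form_def M_def right_diff_distrib sum_subtractf sum_distrib_left)
  qed
  then have "0 \<le> quad_form (pverts G) M y" for y using low[of y] by simp
  moreover have "M v w = M w v" for v w using sym by (simp add: M_def)
  ultimately have "\<exists>(m::nat) g. \<forall>v\<in>pverts G. \<forall>w\<in>pverts G. M v w = (\<Sum>k<m. g v k * g w k)"
    by (intro psd_imp_gram fin)
  then obtain m :: nat and g where g: "\<And>v w. v \<in> pverts G \<Longrightarrow> w \<in> pverts G \<Longrightarrow>
      M v w = (\<Sum>k<m. g v k * g w k)"
    by blast
  \<comment> \<open>For the arc from \<open>p\<close> to \<open>q\<close>, the squared distance of
    \<open>g p\<close> and \<open>g q\<close> is \<open>- 2 * l - 2\<close>, so in fact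
    \<open>l \<le> -1\<close>.\<close>
  have l: "l < 0"
  proof -
    have "0 \<le> (\<Sum>k<m. (g p k - g q k)\<^sup>2)" by (intro sum_nonneg) simp
    also have "\<dots> = (\<Sum>k<m. g p k * g p k - 2 * (g p k * g q k) + g q k * g q k)"
      by (intro sum.cong refl) (simp add: power2_eq_square algebra_simps)
    also have "\<dots> = M p p - 2 * M p q + M q q"
      using pqV by (simp only: g sum.distrib sum_subtractf sum_distrib_left)
    also have "\<dots> = - 2 * l - 2" using pqV pq diag by (simp add: M_def) (simp add: a_def)
    finally show ?thesis by simp
  qed
  define deg where "deg v = real (out_degree (with_proj G) v)" for v
  have rowsum: "(\<Sum>w\<in>pverts G. M v w) = deg v - l" if "v \<in> pverts G" for v
  proof -
    have "out_arcs (with_proj G) v = Pair v ` {w \<in> pverts G. (v, w) \<in> parcs G}"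
      by (auto simp: out_arcs_def dest: in_arcsD2)
    then have "deg v = real (card {w \<in> pverts G. (v, w) \<in> parcs G})"
      by (simp add: deg_def out_degree_def card_image inj_on_def)
    also have "\<dots> = (\<Sum>w\<in>pverts G. a v w)"
      using fin by (simp add: a_def sum.If_cases Int_def)
    finally show ?thesis using that fin by (simp add: M_def sum_subtractf)
  qed
  have degmin: "real (min_degree G) \<le> deg v" if "v \<in> pverts G" for v
    using that fin by (auto simp: min_degree_def deg_def intro!: Min_le)
  \<comment> \<open>Every \<open>g v\<close> has squared length \<open>M v v = - l\<close>, so this
    scaling produces unit vectors.\<close>
  define f where "f v k = g v k / sqrt (- l)" for v k
  have f: "(\<Sum>k<m. f v k * f w k) = M v w / (- l)" if "v \<in> pverts G" "w \<in> pverts G" for v w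
    using that l by (simp add: f_def g sum_divide_distrib sum_negf)
  define s where "s k = (\<Sum>v\<in>pverts G. f v k)" for k
  have sf: "(\<Sum>k<m. s k * f v k) = (deg v - l) / (- l)" if "v \<in> pverts G" for v
  proof -
    have "(\<Sum>k<m. s k * f v k) = (\<Sum>k<m. \<Sum>w\<in>pverts G. f v k * f w k)"
      by (simp add: s_def sum_distrib_left mult_ac)
    also have "\<dots> = (\<Sum>w\<in>pverts G. M v w / (- l))"
      by (subst sum.swap) (simp add: f that)
    also have "\<dots> = (deg v - l) / (- l)"
      by (simp only: sum_divide_distrib[symmetric] rowsum[OF that])
    finally show ?thesis .
  qed
  \<comment> \<open>\<open>N\<close> is the squared length of \<open>s\<close>, obtained by adding
    \<open>s \<bullet> f v\<close> over all vertices; its positivity permits the normalised handle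
    \<open>c\<close>.\<close>
  define N where "N = real (card (pverts G)) * (avg_degree G - l) / (- l)"
  have card: "real (card (pverts G)) > 0" using fin ne by (simp add: card_gt_0_iff)
  have degsum: "(\<Sum>v\<in>pverts G. deg v) = real (card (pverts G)) * avg_degree G"
    using card by (simp add: avg_degree_def deg_def)
  have ss: "(\<Sum>k<m. s k * s k) = N"
  proof -
    have "(\<Sum>k<m. s k * s k) = (\<Sum>k<m. \<Sum>v\<in>pverts G. s k * f v k)"
      by (simp add: s_def[symmetric] sum_distrib_left[symmetric])
    also have "\<dots> = (\<Sum>v\<in>pverts G. (deg v - l) / (- l))"
      by (subst sum.swap) (simp add: sf)
    also have "\<dots> = N"
      by (simp only: sum_divide_distrib[symmetric] sum_subtractf degsum)
        (simp add: N_def algebra_simps)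
    finally show ?thesis .
  qed
  have "avg_degree G \<ge> 0" by (simp add: avg_degree_def sum_nonneg)
  then have N: "N > 0" using card l unfolding N_def
    by (intro divide_pos_pos mult_pos_pos) auto
  define u where "u v = vec m (f v)" for v
  define c where "c = vec m (\<lambda>k. s k / sqrt N)"
  have rep: "orthonormal_rep G m u"
    using l by (auto simp: orthonormal_rep_def unit_vec_set_def u_def scalar_prod_def
        atLeast0LessThan f M_def diag) (auto simp: a_def)
  have c: "c \<in> unit_vec_set m"
    using N by (simp add: unit_vec_set_def c_def scalar_prod_def atLeast0LessThan
        sum_divide_distrib[symmetric] ss)
  have bound: "1 / ereal ((c \<bullet> u v)\<^sup>2) \<le> ereal (- l * real (card (pverts G)) * (avg_degree G - l)
    / (real (min_degree G) - l)\<^sup>2)" if v: "v \<in> pverts G" for v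
  proof -
    have "c \<bullet> u v = (\<Sum>k<m. s k * f v k / sqrt N)"
      by (simp add: c_def u_def scalar_prod_def atLeast0LessThan)
    also have "\<dots> = (deg v - l) / (- l) / sqrt N"
      by (simp only: sum_divide_distrib[symmetric] sf[OF v])
    finally have cu: "(c \<bullet> u v)\<^sup>2 = (deg v - l)\<^sup>2 / (l\<^sup>2 * N)"
      using N by (simp add: power_divide power_mult_distrib)
    have "0 < real (min_degree G) - l" using l by simp
    then have le: "0 < (real (min_degree G) - l)\<^sup>2" "(real (min_degree G) - l)\<^sup>2 \<le> (deg v - l)\<^sup>2"
      using degmin[OF v] by (auto intro: power_mono)
    have pos: "0 < (c \<bullet> u v)\<^sup>2"
      unfolding cu using l N le by (intro divide_pos_pos mult_pos_pos) auto
    have "1 / (c \<bullet> u v)\<^sup>2 = l\<^sup>2 * N / (deg v - l)\<^sup>2" by (simp add: cu)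
    \<comment> \<open>Since \<open>l\<close> is negative, the minimum degree minus \<open>l\<close>
      is positive, so squaring preserves its comparison with \<open>deg v - l\<close>.\<close>
    also have "\<dots> \<le> l\<^sup>2 * N / (real (min_degree G) - l)\<^sup>2"
      using le N l by (intro divide_left_mono mult_pos_pos) auto
    also have "l\<^sup>2 * N = - l * real (card (pverts G)) * (avg_degree G - l)"
      using l by (simp add: N_def power2_eq_square)
    finally show ?thesis using pos by (simp add: one_ereal_def)
  qed
  have "lovasz_number G \<le> rep_value G m u"
    unfolding lovasz_number_def by (rule INF_lower2[of "(m, u)"]) (use rep in auto)
  also have "\<dots> \<le> (MAX v\<in>pverts G. 1 / ereal ((c \<bullet> u v)\<^sup>2))"
    unfolding rep_value_def by (rule INF_lower[OF c])
  also have "\<dots> \<le> ereal (- l * real (card (pverts G)) * (avg_degree G - l)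
    / (real (min_degree G) - l)\<^sup>2)"
    using fin ne bound by (subst Max_le_iff) simp_all
  finally show ?thesis .
qed

theorem theorem4p4:
  fixes G :: "'a pair_pre_digraph" and vs :: "'a list"
    and n \<delta> :: nat and d l :: real
  assumes "pair_graph G"
    and "n = card (pverts G)"
    and "distinct vs" and "set vs = pverts G"
    and "\<delta> = min_degree G"
    and "d = avg_degree G" and "d > 0"
    and "l = min_eigenvalue (adjacency_matrix G vs)"
  shows "ereal (real (independence_number G)) \<le> lovasz_number G \<and>
    lovasz_number G \<le> ereal ((- l * real n * (d - l)) / (real \<delta> - l)\<^sup>2)"
proof -
  interpret pair_graph G by fact
  \<comment> \<open>Positive average degree excludes both degenerate cases: without vertices the
    average is 0 / 0 = 0, and without arcs every degree is 0.\<close>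
  have ne: "pverts G \<noteq> {}" and arcs: "parcs G \<noteq> {}"
    using assms(6,7) by (auto simp: avg_degree_def out_degree_def out_arcs_def)
  show ?thesis
    using lovasz_number_ge_independence_number[OF pair_finite_verts ne]
      lovasz_number_le_psd_bound[OF assms(1) arcs
        min_eigenvalue_adjacency_matrix[OF assms(1) ne assms(3,4)]]
    by (simp add: assms(2,5,6,8))
qed

end
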